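(* Let $\mathfrak{g}$ be a Lie algebra over $\mathbb{C}$ of countable dimension equipped with a nondegenerate symmetric invariant bilinear form $\langle\cdot,\cdot\rangle$, and let $\hat{\mathfrak{g}}$ be the associated affine Lie algebra. Let $W$ be an irreducible restricted $\hat{\mathfrak{g}}$-module and let $U$ be an irreducible $\hat{\mathfrak{g}}$-module in the category $\mathcal{E}$. Then the tensor product $\hat{\mathfrak{g}}$-module $W\otimes U$ is irreducible.
   Context: $\hat{\mathfrak{g}}=\mathfrak{g}\otimes\mathbb{C}[t,t^{-1}]\oplus\mathbb{C}\mathbf{k}$ with $\mathbf{k}$ central and $[a\otimes t^{m},b\otimes t^{n}]=[a,b]\otimes t^{m+n}+m\langle a,b\rangle\delta_{m+n,0}\mathbf{k}$. On a $\hat{\mathfrak{g}}$-module, $a(n)$ denotes the action of $a\otimes t^n$, and $a(x)=\sum_{n\in\mathbb{Z}}a(n)x^{-n-1}$. A $\hat{\mathfrak{g}}$-module $W$ is restricted if for all $a\in\mathfrak{g}$, $w\in W$, $a(n)w=0$ for $n$ sufficiently large. A $\hat{\mathfrak{g}}$-module $U$ is in the category $\mathcal{E}$ if there is a nonzero polynomial $p(x)\in\mathbb{C}[x]$ such that $p(x)a(x)u=0$ for all $a\in\mathfrak{g}$, $u\in U$. *)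

theory Defs
  imports Complex_Main
    "HOL-Library.Poly_Mapping"
    "HOL-Library.Product_Plus"
    "HOL-Library.Countable_Set"
    "HOL-Computational_Algebra.Polynomial"
begin

section \<open>Complex vector spaces\<close>

class complex_vector = ab_group_add +
  fixes scaleC :: "complex \<Rightarrow> 'a \<Rightarrow> 'a"  (infixr \<open>*\<^sub>C\<close> 75)
  assumes scaleC_add_right: "c *\<^sub>C (x + y) = c *\<^sub>C x + c *\<^sub>C y"
    and scaleC_add_left: "(c + d) *\<^sub>C x = c *\<^sub>C x + d *\<^sub>C x"
    and scaleC_scaleC: "c *\<^sub>C d *\<^sub>C x = (c * d) *\<^sub>C x"
    and scaleC_one: "1 *\<^sub>C x = x"

global_interpretation complex_vector:
  vector_space "scaleC :: complex \<Rightarrow> 'a \<Rightarrow> 'a :: complex_vector"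
  by unfold_locales (simp_all add: scaleC_add_right scaleC_add_left scaleC_scaleC scaleC_one)

abbreviation clinear :: "('a::complex_vector \<Rightarrow> 'b::complex_vector) \<Rightarrow> bool"
  where "clinear \<equiv> Vector_Spaces.linear scaleC scaleC"

lemma clinear_iff:
  "clinear f \<longleftrightarrow> (\<forall>x y. f (x + y) = f x + f y) \<and> (\<forall>c x. f (c *\<^sub>C x) = c *\<^sub>C f x)"
  by (simp add: Vector_Spaces.linear_def module_hom_def module_hom_axioms_def
      complex_vector.vector_space_axioms complex_vector.module_axioms)

definition cbilinear ::
    "('a::complex_vector \<Rightarrow> 'b::complex_vector \<Rightarrow> 'c::complex_vector) \<Rightarrow> bool"
  where "cbilinear f \<longleftrightarrow> (\<forall>x. clinear (f x)) \<and> (\<forall>y. clinear (\<lambda>x. f x y))"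

lemma cbilinear_iff:
  "cbilinear f \<longleftrightarrow>
    (\<forall>x y z. f (x + y) z = f x z + f y z) \<and> (\<forall>x y z. f x (y + z) = f x y + f x z) \<and>
    (\<forall>c x y. f (c *\<^sub>C x) y = c *\<^sub>C f x y) \<and> (\<forall>c x y. f x (c *\<^sub>C y) = c *\<^sub>C f x y)"
  unfolding cbilinear_def clinear_iff by blast

lemma
  assumes "cbilinear f"
  shows cbilinear_add_left: "f (x + x') y = f x y + f x' y"
    and cbilinear_add_right: "f x (y + y') = f x y + f x y'"
    and cbilinear_scale_left: "f (c *\<^sub>C x) y = c *\<^sub>C f x y"
    and cbilinear_scale_right: "f x (c *\<^sub>C y) = c *\<^sub>C f x y"
  using assms by (auto simp: cbilinear_iff)

lemma
  assumes "cbilinear f"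
  shows cbilinear_zero_left: "f 0 y = 0"
    and cbilinear_zero_right: "f x 0 = 0"
  using cbilinear_add_left[OF assms, of 0 0 y] cbilinear_add_right[OF assms, of x 0 0] by auto

definition countable_dimension :: "'a::complex_vector itself \<Rightarrow> bool"
  where "countable_dimension _ \<longleftrightarrow>
    (\<exists>B :: 'a set. countable B \<and> complex_vector.independent B \<and> complex_vector.span B = UNIV)"

instantiation complex :: complex_vector
begin

definition scaleC_complex_def [simp]: "c *\<^sub>C (z :: complex) = c * z"

instance by standard (simp_all add: algebra_simps)

end

instantiation prod :: (complex_vector, complex_vector) complex_vector
begin

definition scaleC_prod_def: "c *\<^sub>C p = (c *\<^sub>C fst p, c *\<^sub>C snd p)"

instance
  by standard (simp_all add: scaleC_prod_def prod_eq_iff scaleC_add_right scaleC_add_left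
      scaleC_scaleC scaleC_one)

end

instantiation poly_mapping :: (type, complex_vector) complex_vector
begin

definition scaleC_poly_mapping_def: "c *\<^sub>C f = Poly_Mapping.map (scaleC c) f"

lemma lookup_scaleC [simp]: "Poly_Mapping.lookup (c *\<^sub>C f) k = c *\<^sub>C Poly_Mapping.lookup f k"
  by (simp add: scaleC_poly_mapping_def map.rep_eq when_def)

instance
  by standard (rule poly_mapping_eqI, simp add: lookup_add scaleC_add_right scaleC_add_left
      scaleC_scaleC scaleC_one)+

end

lemma scaleC_single: "c *\<^sub>C Poly_Mapping.single k x = Poly_Mapping.single k (c *\<^sub>C x)"
  by (rule poly_mapping_eqI) (simp add: lookup_single when_def)

section \<open>Tensor product of complex vector spaces\<close>

text \<open>
  The free vector space on the set of pairs modulo the span of the bilinearity relations.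
\<close>

abbreviation free_pair :: "'a \<Rightarrow> 'b \<Rightarrow> ('a \<times> 'b) \<Rightarrow>\<^sub>0 complex"
  where "free_pair x y \<equiv> Poly_Mapping.single (x, y) 1"

inductive_set tensor_relations ::
    "(('a::complex_vector \<times> 'b::complex_vector) \<Rightarrow>\<^sub>0 complex) set"
  where
    add_left: "free_pair (x + x') y - (free_pair x y + free_pair x' y) \<in> tensor_relations"
  | add_right: "free_pair x (y + y') - (free_pair x y + free_pair x y') \<in> tensor_relations"
  | scale_left: "free_pair (c *\<^sub>C x) y - c *\<^sub>C free_pair x y \<in> tensor_relations"
  | scale_right: "free_pair x (c *\<^sub>C y) - c *\<^sub>C free_pair x y \<in> tensor_relations"

definition tensor_eq ::
    "(('a::complex_vector \<times> 'b::complex_vector) \<Rightarrow>\<^sub>0 complex)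
      \<Rightarrow> (('a \<times> 'b) \<Rightarrow>\<^sub>0 complex) \<Rightarrow> bool"
  where "tensor_eq p q \<longleftrightarrow> p - q \<in> complex_vector.span tensor_relations"

lemma equivp_tensor_eq: "equivp (tensor_eq ::
  (('a::complex_vector \<times> 'b::complex_vector) \<Rightarrow>\<^sub>0 complex) \<Rightarrow> _ \<Rightarrow> _)"
  (is "equivp ?R")
proof (rule equivpI)
  show "reflp ?R"
    by (rule reflpI) (simp add: tensor_eq_def complex_vector.span_zero)
  show "symp ?R"
  proof (rule sympI)
    fix p q :: "('a \<times> 'b) \<Rightarrow>\<^sub>0 complex"
    assume "tensor_eq p q"
    then have "- (p - q) \<in> complex_vector.span tensor_relations"
      unfolding tensor_eq_def by (rule complex_vector.span_neg)
    then show "tensor_eq q p" by (simp add: tensor_eq_def)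
  qed
  show "transp ?R"
  proof (rule transpI)
    fix p q r :: "('a \<times> 'b) \<Rightarrow>\<^sub>0 complex"
    assume "tensor_eq p q" "tensor_eq q r"
    then have "(p - q) + (q - r) \<in> complex_vector.span tensor_relations"
      unfolding tensor_eq_def by (rule complex_vector.span_add)
    then show "tensor_eq p r" by (simp add: tensor_eq_def)
  qed
qed

quotient_type (overloaded) ('a, 'b) tensor =
  "('a::complex_vector \<times> 'b::complex_vector) \<Rightarrow>\<^sub>0 complex" / tensor_eq
  by (rule equivp_tensor_eq)

instantiation tensor :: (complex_vector, complex_vector) complex_vector
begin

lift_definition zero_tensor :: "('a, 'b) tensor" is 0 .

lift_definition plus_tensor :: "('a, 'b) tensor \<Rightarrow> ('a, 'b) tensor \<Rightarrow> ('a, 'b) tensor" is "(+)"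
  unfolding tensor_eq_def add_diff_add by (rule complex_vector.span_add)

lift_definition minus_tensor :: "('a, 'b) tensor \<Rightarrow> ('a, 'b) tensor \<Rightarrow> ('a, 'b) tensor" is "(-)"
proof -
  fix p p' q q' :: "('a \<times> 'b) \<Rightarrow>\<^sub>0 complex"
  assume "tensor_eq p p'" "tensor_eq q q'"
  then have "(p - p') - (q - q') \<in> complex_vector.span tensor_relations"
    unfolding tensor_eq_def by (rule complex_vector.span_diff)
  also have "(p - p') - (q - q') = (p - q) - (p' - q')" by (simp add: algebra_simps)
  finally show "tensor_eq (p - q) (p' - q')" by (simp add: tensor_eq_def)
qed

lift_definition uminus_tensor :: "('a, 'b) tensor \<Rightarrow> ('a, 'b) tensor" is uminus
  unfolding tensor_eq_def minus_diff_minus by (rule complex_vector.span_neg)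

lift_definition scaleC_tensor :: "complex \<Rightarrow> ('a, 'b) tensor \<Rightarrow> ('a, 'b) tensor" is scaleC
  unfolding tensor_eq_def complex_vector.scale_right_diff_distrib[symmetric]
  by (rule complex_vector.span_scale)

instance
proof
  fix a b c :: "('a, 'b) tensor" and x y :: complex
  have eq: "tensor_eq p q" if "p = q" for p q :: "('a \<times> 'b) \<Rightarrow>\<^sub>0 complex"
    using that by (simp add: tensor_eq_def complex_vector.span_zero)
  show "a + b + c = a + (b + c)" by transfer (rule eq, simp add: add.assoc)
  show "a + b = b + a" by transfer (rule eq, simp add: add.commute)
  show "0 + a = a" by transfer (rule eq, simp)
  show "- a + a = 0" by transfer (rule eq, simp)
  show "a - b = a + - b" by transfer (rule eq, simp)
  show "x *\<^sub>C (a + b) = x *\<^sub>C a + x *\<^sub>C b" by transfer (rule eq, rule scaleC_add_right)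
  show "(x + y) *\<^sub>C a = x *\<^sub>C a + y *\<^sub>C a" by transfer (rule eq, rule scaleC_add_left)
  show "x *\<^sub>C y *\<^sub>C a = (x * y) *\<^sub>C a" by transfer (rule eq, rule scaleC_scaleC)
  show "1 *\<^sub>C a = a" by transfer (rule eq, rule scaleC_one)
qed

end

lift_definition tensor_of :: "'a::complex_vector \<Rightarrow> 'b::complex_vector \<Rightarrow> ('a, 'b) tensor"
    (infixr \<open>\<otimes>\<close> 75)
  is free_pair .

lemma cbilinear_tensor_of: "cbilinear (\<otimes>)"
proof -
  have "tensor_eq (free_pair (x + x') y) (free_pair x y + free_pair x' y)"
    and "tensor_eq (free_pair x (y + y')) (free_pair x y + free_pair x y')"
    and "tensor_eq (free_pair (c *\<^sub>C x) y) (c *\<^sub>C free_pair x y)"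
    and "tensor_eq (free_pair x (c *\<^sub>C y)) (c *\<^sub>C free_pair x y)"
    for x x' :: 'a and y y' :: 'b and c
    unfolding tensor_eq_def
    by (rule complex_vector.span_base, rule tensor_relations.intros)+
  then show ?thesis
    by (simp add: cbilinear_iff tensor_of.abs_eq plus_tensor.abs_eq scaleC_tensor.abs_eq
        tensor.abs_eq_iff)
qed

definition free_extend ::
    "('a \<Rightarrow> 'b \<Rightarrow> 'c::complex_vector) \<Rightarrow> (('a \<times> 'b) \<Rightarrow>\<^sub>0 complex) \<Rightarrow> 'c"
  where "free_extend f p = (\<Sum>k\<in>Poly_Mapping.keys p. Poly_Mapping.lookup p k *\<^sub>C f (fst k) (snd k))"

lemma free_extend_superset:
  assumes "finite K" "Poly_Mapping.keys p \<subseteq> K"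
  shows "free_extend f p = (\<Sum>k\<in>K. Poly_Mapping.lookup p k *\<^sub>C f (fst k) (snd k))"
  unfolding free_extend_def using assms
  by (intro sum.mono_neutral_left) (auto simp: in_keys_iff)

lemma clinear_free_extend: "clinear (free_extend f)"
  unfolding clinear_iff
proof (intro conjI allI)
  fix p q :: "('a \<times> 'b) \<Rightarrow>\<^sub>0 complex" and c
  let ?K = "Poly_Mapping.keys p \<union> Poly_Mapping.keys q"
  have "Poly_Mapping.keys (p + q) \<subseteq> ?K" by (rule keys_add)
  then show "free_extend f (p + q) = free_extend f p + free_extend f q"
    using free_extend_superset[of ?K p f] free_extend_superset[of ?K q f]
      free_extend_superset[of ?K "p + q" f]
    by (simp add: lookup_add scaleC_add_left sum.distrib)
  have "Poly_Mapping.keys (c *\<^sub>C p) \<subseteq> Poly_Mapping.keys p" by (auto simp: in_keys_iff)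
  then show "free_extend f (c *\<^sub>C p) = c *\<^sub>C free_extend f p"
    using free_extend_superset[of "Poly_Mapping.keys p" "c *\<^sub>C p" f]
    by (simp add: free_extend_def complex_vector.scale_sum_right)
qed

lemma free_extend_single [simp]: "free_extend f (free_pair x y) = f x y"
  by (simp add: free_extend_def scaleC_one)

text \<open>
  The map out of the tensor product induced by \<open>f\<close>. It is independent of the chosen representative
  only for bilinear \<open>f\<close>, see the lemmas below.
\<close>

definition tensor_lift ::
    "('a::complex_vector \<Rightarrow> 'b::complex_vector \<Rightarrow> 'c::complex_vector) \<Rightarrow> ('a, 'b) tensor \<Rightarrow> 'c"
  where "tensor_lift f t = free_extend f (rep_tensor t)"

lemma free_extend_cong_tensor_eq:
  assumes f: "cbilinear f" and pq: "tensor_eq p q"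
  shows "free_extend f p = free_extend f q"
proof -
  interpret F: Vector_Spaces.linear scaleC scaleC "free_extend f" by (rule clinear_free_extend)
  have "free_extend f r = 0" if "r \<in> tensor_relations" for r
    using that
    by cases (simp_all add: F.diff F.add F.scale cbilinear_add_left[OF f] cbilinear_add_right[OF f]
        cbilinear_scale_left[OF f] cbilinear_scale_right[OF f])
  then have "free_extend f (p - q) = 0"
    using pq unfolding tensor_eq_def by (rule F.eq_0_on_span)
  then show ?thesis by (simp add: F.diff)
qed

lemma tensor_lift_abs:
  assumes "cbilinear f"
  shows "tensor_lift f (abs_tensor p) = free_extend f p"
proof -
  have "abs_tensor (rep_tensor (abs_tensor p)) = abs_tensor p"
    by (rule Quotient_abs_rep[OF Quotient_tensor])
  then have "tensor_eq (rep_tensor (abs_tensor p)) p"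
    by (simp add: tensor.abs_eq_iff)
  then show ?thesis
    unfolding tensor_lift_def by (rule free_extend_cong_tensor_eq[OF assms])
qed

lemma tensor_lift_tensor_of [simp]:
  assumes "cbilinear f"
  shows "tensor_lift f (x \<otimes> y) = f x y"
  by (simp add: tensor_of.abs_eq tensor_lift_abs[OF assms])

lemma clinear_tensor_lift:
  assumes "cbilinear f"
  shows "clinear (tensor_lift f)"
proof -
  have "tensor_lift f (s + t) = tensor_lift f s + tensor_lift f t" for s t
    using clinear_free_extend[of f]
    by (induct s rule: tensor.abs_induct; induct t rule: tensor.abs_induct)
      (simp add: plus_tensor.abs_eq tensor_lift_abs[OF assms] clinear_iff)
  moreover have "tensor_lift f (c *\<^sub>C t) = c *\<^sub>C tensor_lift f t" for c t
    using clinear_free_extend[of f]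
    by (induct t rule: tensor.abs_induct)
      (simp add: scaleC_tensor.abs_eq tensor_lift_abs[OF assms] clinear_iff)
  ultimately show ?thesis by (simp add: clinear_iff)
qed

lemma tensor_induct [case_names tensor add scale]:
  assumes "\<And>x y. P (x \<otimes> y)" "\<And>s t. P s \<Longrightarrow> P t \<Longrightarrow> P (s + t)" "\<And>c t. P t \<Longrightarrow> P (c *\<^sub>C t)"
  shows "P t"
proof -
  have "P (abs_tensor p)" for p
  proof (induction p rule: update_induct)
    case const
    have "P (0 *\<^sub>C (0 \<otimes> 0))" by (intro assms)
    then show ?case by (simp add: zero_tensor.abs_eq)
  next
    case (update p k c)
    obtain x y where k: "k = (x, y)" by (cases k)
    have "Poly_Mapping.update k c p = p + c *\<^sub>C free_pair x y"
      using update(1) by (intro poly_mapping_eqI)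
        (auto simp: lookup_update lookup_add lookup_single when_def k in_keys_iff)
    then have "abs_tensor (Poly_Mapping.update k c p) = abs_tensor p + c *\<^sub>C (x \<otimes> y)"
      by (simp add: plus_tensor.abs_eq scaleC_tensor.abs_eq tensor_of.abs_eq)
    then show ?case using assms update by simp
  qed
  then show ?thesis by (induct t rule: tensor.abs_induct)
qed

section \<open>Lie algebras and their modules\<close>

locale lie_algebra =
  fixes brk :: "'g::complex_vector \<Rightarrow> 'g \<Rightarrow> 'g"
  assumes bilinear: "cbilinear brk"
    and alternating: "brk x x = 0"
    and jacobi: "brk x (brk y z) + brk y (brk z x) + brk z (brk x y) = 0"

locale lie_algebra_form = lie_algebra brk
  for brk :: "'g::complex_vector \<Rightarrow> 'g \<Rightarrow> 'g" +
  fixes form :: "'g \<Rightarrow> 'g \<Rightarrow> complex"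
  assumes form_bilinear: "cbilinear form"
    and form_symmetric: "form x y = form y x"
    and form_invariant: "form (brk x y) z = form x (brk y z)"
    and form_nondegenerate: "(\<forall>y. form x y = 0) \<Longrightarrow> x = 0"

locale lie_module = lie_algebra brk
  for brk :: "'l::complex_vector \<Rightarrow> 'l \<Rightarrow> 'l" +
  fixes act :: "'l \<Rightarrow> 'v::complex_vector \<Rightarrow> 'v"
  assumes act_bilinear: "cbilinear act"
    and act_brk: "act (brk x y) v = act x (act y v) - act y (act x v)"

definition submodule :: "('l \<Rightarrow> 'v::complex_vector \<Rightarrow> 'v) \<Rightarrow> 'v set \<Rightarrow> bool"
  where "submodule act N \<longleftrightarrow> complex_vector.subspace N \<and> (\<forall>x. \<forall>v\<in>N. act x v \<in> N)"

definition irreducible_module ::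
    "('l::complex_vector \<Rightarrow> 'l \<Rightarrow> 'l) \<Rightarrow> ('l \<Rightarrow> 'v::complex_vector \<Rightarrow> 'v) \<Rightarrow> bool"
  where "irreducible_module brk act \<longleftrightarrow>
    lie_module brk act \<and> (UNIV :: 'v set) \<noteq> {0} \<and>
    (\<forall>N. submodule act N \<longrightarrow> N = {0} \<or> N = UNIV)"

definition tensor_act ::
    "('l \<Rightarrow> 'v::complex_vector \<Rightarrow> 'v) \<Rightarrow> ('l \<Rightarrow> 'w::complex_vector \<Rightarrow> 'w)
      \<Rightarrow> 'l \<Rightarrow> ('v, 'w) tensor \<Rightarrow> ('v, 'w) tensor"
  where "tensor_act act1 act2 x = tensor_lift (\<lambda>v w. act1 x v \<otimes> w + v \<otimes> act2 x w)"

context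
  fixes brk :: "'l::complex_vector \<Rightarrow> 'l \<Rightarrow> 'l"
    and act1 :: "'l \<Rightarrow> 'v::complex_vector \<Rightarrow> 'v" and act2 :: "'l \<Rightarrow> 'w::complex_vector \<Rightarrow> 'w"
  assumes m1: "lie_module brk act1" and m2: "lie_module brk act2"
begin

private lemmas b1 = lie_module.act_bilinear[OF m1]
private lemmas b2 = lie_module.act_bilinear[OF m2]
private lemmas bilin_simps =
  cbilinear_add_left[OF b1] cbilinear_add_right[OF b1]
  cbilinear_scale_left[OF b1] cbilinear_scale_right[OF b1]
  cbilinear_add_left[OF b2] cbilinear_add_right[OF b2]
  cbilinear_scale_left[OF b2] cbilinear_scale_right[OF b2]
  cbilinear_add_left[OF cbilinear_tensor_of] cbilinear_add_right[OF cbilinear_tensor_of]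
  cbilinear_scale_left[OF cbilinear_tensor_of] cbilinear_scale_right[OF cbilinear_tensor_of]

private lemma bilin: "cbilinear (\<lambda>v w. act1 x v \<otimes> w + v \<otimes> act2 x w)"
  unfolding cbilinear_iff by (simp add: bilin_simps scaleC_add_right algebra_simps)

lemma tensor_act_tensor_of:
  "tensor_act act1 act2 x (v \<otimes> w) = act1 x v \<otimes> w + v \<otimes> act2 x w"
  by (simp add: tensor_act_def bilin)

private lemma act_lin: "clinear (tensor_act act1 act2 x)"
  unfolding tensor_act_def by (rule clinear_tensor_lift[OF bilin])

lemma lie_module_tensor_act: "lie_module brk (tensor_act act1 act2)"
proof -
  let ?a = "tensor_act act1 act2"
  have R: "?a x (s + t) = ?a x s + ?a x t" "?a x (c *\<^sub>C t) = c *\<^sub>C ?a x t" for x s t c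
    using act_lin[of x] by (simp_all add: clinear_iff)
  have L1: "?a (x + y) t = ?a x t + ?a y t" for x y t
    by (induction t rule: tensor_induct)
      (simp_all add: R tensor_act_tensor_of bilin_simps scaleC_add_right algebra_simps)
  have L2: "?a (c *\<^sub>C x) t = c *\<^sub>C ?a x t" for c x t
    by (induction t rule: tensor_induct)
      (simp_all add: R tensor_act_tensor_of bilin_simps scaleC_add_right scaleC_scaleC mult.commute)
  have D: "(u - v) \<otimes> w = u \<otimes> w - v \<otimes> w" "s \<otimes> (p - q) = s \<otimes> p - s \<otimes> q"
    for u v s :: 'v and w p q :: 'w
    by (metis add_diff_cancel_right' diff_add_cancel cbilinear_add_left[OF cbilinear_tensor_of],
        metis add_diff_cancel_right' diff_add_cancel cbilinear_add_right[OF cbilinear_tensor_of])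
  have B: "?a (brk x y) t = ?a x (?a y t) - ?a y (?a x t)" for x y t
  proof (induction t rule: tensor_induct)
    case (scale c t)
    then show ?case by (simp only: R complex_vector.scale_right_diff_distrib)
  qed (simp_all add: R tensor_act_tensor_of D lie_module.act_brk[OF m1] lie_module.act_brk[OF m2]
        algebra_simps)
  show ?thesis
    using m1 by (intro lie_module.intro lie_module_axioms.intro)
      (simp_all add: lie_module_def cbilinear_iff R L1 L2 B)
qed

end

section \<open>The affine Lie algebra\<close>

text \<open>
  A finitely supported \<open>f :: int \<Rightarrow>\<^sub>0 'g\<close> represents the element \<open>\<Sum>n. f n \<otimes> t^n\<close> of
  the loop algebra, and the second component is the coefficient of the central element.
\<close>

type_synonym 'g affine = "(int \<Rightarrow>\<^sub>0 'g) \<times> complex"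

definition affine_monom :: "'g::complex_vector \<Rightarrow> int \<Rightarrow> 'g affine"
  where "affine_monom a n = (Poly_Mapping.single n a, 0)"

definition affine_central :: "'g::complex_vector affine"
  where "affine_central = (0, 1)"

definition affine_brk ::
    "('g::complex_vector \<Rightarrow> 'g \<Rightarrow> 'g) \<Rightarrow> ('g \<Rightarrow> 'g \<Rightarrow> complex) \<Rightarrow> 'g affine \<Rightarrow> 'g affine \<Rightarrow> 'g affine"
  where "affine_brk brk form X Y =
    (\<Sum>m\<in>Poly_Mapping.keys (fst X). \<Sum>n\<in>Poly_Mapping.keys (fst Y).
      affine_monom (brk (Poly_Mapping.lookup (fst X) m) (Poly_Mapping.lookup (fst Y) n)) (m + n)
      + (if m + n = 0 then of_int m * form (Poly_Mapping.lookup (fst X) m) (Poly_Mapping.lookup (fst Y) n) else 0)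
          *\<^sub>C affine_central)"

lemma affine_monom_add: "affine_monom (a + b) n = affine_monom a n + affine_monom b n"
  by (simp add: affine_monom_def single_add)

lemma affine_monom_scale: "affine_monom (c *\<^sub>C a) n = c *\<^sub>C affine_monom a n"
  by (simp add: affine_monom_def scaleC_prod_def scaleC_single)

lemma affine_monom_zero [simp]: "affine_monom 0 n = 0"
  by (simp add: affine_monom_def zero_prod_def)

lemma affine_induct [case_names monom central add]:
  assumes "\<And>a n. P (affine_monom a n)" "\<And>c. P (c *\<^sub>C affine_central)"
    "\<And>X Y. P X \<Longrightarrow> P Y \<Longrightarrow> P (X + Y)"
  shows "P (X :: 'g::complex_vector affine)"
proof -
  have "P (f, 0)" for f
  proof (induction f rule: update_induct)
    case const
    then show ?case using assms(1)[of 0 0] by (simp add: zero_prod_def)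
  next
    case (update f n a)
    have "Poly_Mapping.update n a f = f + Poly_Mapping.single n a"
      using update(1) by (intro poly_mapping_eqI)
        (auto simp: lookup_update lookup_add lookup_single when_def in_keys_iff)
    then have "(Poly_Mapping.update n a f, 0) = (f, 0) + affine_monom a n"
      by (simp add: affine_monom_def)
    then show ?case using assms(1,3) update(3) by metis
  qed
  moreover have "X = (fst X, 0) + snd X *\<^sub>C affine_central"
    by (simp add: prod_eq_iff affine_central_def scaleC_prod_def)
  ultimately show ?thesis using assms(2,3) by metis
qed

context lie_algebra_form
begin

context
begin

private abbreviation "term_brk X Y m n \<equiv>
  affine_monom (brk (Poly_Mapping.lookup (fst X) m) (Poly_Mapping.lookup (fst Y) n)) (m + n)
  + (if m + n = 0 then of_int m * form (Poly_Mapping.lookup (fst X) m) (Poly_Mapping.lookup (fst Y) n) else 0)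
      *\<^sub>C affine_central"

private lemma affine_brk_superset:
  assumes "finite M" "finite N" "Poly_Mapping.keys (fst X) \<subseteq> M" "Poly_Mapping.keys (fst Y) \<subseteq> N"
  shows "affine_brk brk form X Y = (\<Sum>m\<in>M. \<Sum>n\<in>N. term_brk X Y m n)"
proof -
  have z: "term_brk X Y m n = 0"
    if "m \<notin> Poly_Mapping.keys (fst X) \<or> n \<notin> Poly_Mapping.keys (fst Y)" for m n
    using that cbilinear_zero_left[OF bilinear] cbilinear_zero_right[OF bilinear]
      cbilinear_zero_left[OF form_bilinear] cbilinear_zero_right[OF form_bilinear]
    by (auto simp: in_keys_iff)
  have "affine_brk brk form X Y
      = (\<Sum>m\<in>Poly_Mapping.keys (fst X). \<Sum>n\<in>N. term_brk X Y m n)"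
    unfolding affine_brk_def using assms z
    by (intro sum.cong refl sum.mono_neutral_left) auto
  also have "\<dots> = (\<Sum>m\<in>M. \<Sum>n\<in>N. term_brk X Y m n)"
    using assms z by (intro sum.mono_neutral_left) (auto intro!: sum.neutral)
  finally show ?thesis .
qed

private lemmas bil =
  cbilinear_add_left[OF bilinear] cbilinear_add_right[OF bilinear]
  cbilinear_scale_left[OF bilinear] cbilinear_scale_right[OF bilinear]
  cbilinear_add_left[OF form_bilinear] cbilinear_add_right[OF form_bilinear]
  cbilinear_scale_left[OF form_bilinear] cbilinear_scale_right[OF form_bilinear]

private lemmas nil =
  cbilinear_zero_left[OF bilinear] cbilinear_zero_right[OF bilinear]
  cbilinear_zero_left[OF form_bilinear] cbilinear_zero_right[OF form_bilinear]

lemma cbilinear_affine_brk: "cbilinear (affine_brk brk form)"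
  unfolding cbilinear_iff
proof (intro conjI allI)
  fix X Y Z :: "'g affine" and c
  let ?K = "\<lambda>X :: 'g affine. Poly_Mapping.keys (fst X)"
  have k: "?K (X + Y) \<subseteq> ?K X \<union> ?K Y" "?K (c *\<^sub>C X) \<subseteq> ?K X" for X Y
    using keys_add[of "fst X" "fst Y"] by (auto simp: scaleC_prod_def in_keys_iff)
  show "affine_brk brk form (X + Y) Z = affine_brk brk form X Z + affine_brk brk form Y Z"
    using k(1)[of X Y] affine_brk_superset[of "?K X \<union> ?K Y" "?K Z" _ Z]
    by (simp add: lookup_add bil affine_monom_add sum.distrib[symmetric])
      (intro sum.cong refl, simp add: lookup_add bil affine_monom_add scaleC_add_left algebra_simps)
  show "affine_brk brk form X (Y + Z) = affine_brk brk form X Y + affine_brk brk form X Z"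
    using k(1)[of Y Z] affine_brk_superset[of "?K X" "?K Y \<union> ?K Z" X]
    by (simp add: lookup_add bil affine_monom_add sum.distrib[symmetric])
      (intro sum.cong refl, simp add: lookup_add bil affine_monom_add scaleC_add_left algebra_simps)
  show "affine_brk brk form (c *\<^sub>C X) Y = c *\<^sub>C affine_brk brk form X Y"
    using k(2)[of X] affine_brk_superset[of "?K X" "?K Y" _ Y]
    by (simp add: complex_vector.scale_sum_right)
      (intro sum.cong refl, simp add: scaleC_prod_def[of c X] bil affine_monom_scale
        scaleC_add_right scaleC_scaleC mult.left_commute)
  show "affine_brk brk form X (c *\<^sub>C Y) = c *\<^sub>C affine_brk brk form X Y"
    using k(2)[of Y] affine_brk_superset[of "?K X" "?K Y" X]
    by (simp add: complex_vector.scale_sum_right)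
      (intro sum.cong refl, simp add: scaleC_prod_def[of c Y] bil affine_monom_scale
        scaleC_add_right scaleC_scaleC mult.left_commute)
qed

lemma affine_brk_monom:
  "affine_brk brk form (affine_monom a m) (affine_monom b n) =
    affine_monom (brk a b) (m + n)
    + (if m + n = 0 then of_int m * form a b else 0) *\<^sub>C affine_central"
  using affine_brk_superset[of "{m}" "{n}" "affine_monom a m" "affine_monom b n"]
  by (simp add: affine_monom_def)

lemma affine_brk_central [simp]:
  "affine_brk brk form affine_central X = 0" "affine_brk brk form X affine_central = 0"
  by (simp_all add: affine_brk_def affine_central_def)

private lemma brk_skew: "brk x y = - brk y x"
proof -
  have "brk (x + y) (x + y) = brk x x + brk x y + (brk y x + brk y y)"
    by (simp only: bil ac_simps)
  then have "brk x y + brk y x = 0" by (simp add: alternating)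
  then show ?thesis by (simp add: eq_neg_iff_add_eq_0)
qed

lemma lie_algebra_affine_brk: "lie_algebra (affine_brk brk form)"
proof
  let ?b = "affine_brk brk form"
  note B = cbilinear_add_left[OF cbilinear_affine_brk] cbilinear_add_right[OF cbilinear_affine_brk]
    cbilinear_scale_left[OF cbilinear_affine_brk] cbilinear_scale_right[OF cbilinear_affine_brk]
    cbilinear_zero_left[OF cbilinear_affine_brk] cbilinear_zero_right[OF cbilinear_affine_brk]
  show "cbilinear ?b" by (rule cbilinear_affine_brk)
  have sk0: "?b (affine_monom a m) (affine_monom b n) + ?b (affine_monom b n) (affine_monom a m) = 0"
    for a b m n
  proof -
    have "affine_monom (brk a b) (m + n) + affine_monom (brk b a) (n + m) = 0"
      using brk_skew[of a b] by (simp add: affine_monom_add[symmetric] add.commute)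
    moreover have "(if m + n = 0 then of_int m * form a b else 0)
        + (if n + m = 0 then of_int n * form b a else 0) = (0 :: complex)"
    proof (cases "m + n = 0")
      case True
      then have "n = - m" by simp
      then show ?thesis by (simp add: form_symmetric[of b a])
    qed (simp add: add.commute)
    ultimately show ?thesis
      unfolding affine_brk_monom
      by (metis (no_types, lifting) add.left_neutral add.commute add.left_commute scaleC_add_left
          complex_vector.scale_zero_left)
  qed
  have sk: "?b X Y + ?b Y X = 0" for X Y
  proof (induction X rule: affine_induct)
    case (monom a m)
    show ?case
    proof (induction Y rule: affine_induct)
      case (monom b n)
      show ?case by (rule sk0)
    next
      case (add Y Z)
      have "?b (affine_monom a m) (Y + Z) + ?b (Y + Z) (affine_monom a m)
        = (?b (affine_monom a m) Y + ?b Y (affine_monom a m))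
          + (?b (affine_monom a m) Z + ?b Z (affine_monom a m))"
        by (simp add: B algebra_simps)
      then show ?case using add by simp
    qed (simp add: B)
  next
    case (add X Z)
    have "?b (X + Z) Y + ?b Y (X + Z) = (?b X Y + ?b Y X) + (?b Z Y + ?b Y Z)"
      by (simp add: B algebra_simps)
    then show ?case using add by simp
  qed (simp add: B)
  show "?b X X = 0" for X
  proof -
    have "2 *\<^sub>C ?b X X = 0"
      using sk[of X X] scaleC_add_left[of 1 1 "?b X X"] by (simp add: scaleC_one)
    then show ?thesis by simp
  qed
  let ?J = "\<lambda>X Y Z. ?b X (?b Y Z) + ?b Y (?b Z X) + ?b Z (?b X Y)"
  have J0: "?J (affine_monom a m) (affine_monom b n) (affine_monom c p) = 0" for a b c m n p
  proof -
    have e: "?b (affine_monom a m) (?b (affine_monom b n) (affine_monom c p)) =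
       affine_monom (brk a (brk b c)) (m + n + p)
       + (if m + n + p = 0 then of_int m * form a (brk b c) else 0) *\<^sub>C affine_central"
      for a b c m n p
      by (simp add: affine_brk_monom B add.assoc)
    have f1: "form b (brk c a) = form a (brk b c)" "form c (brk a b) = form a (brk b c)" 
      by (metis form_invariant form_symmetric)+
    have "affine_monom (brk a (brk b c)) (m + n + p) + affine_monom (brk b (brk c a)) (n + p + m)
        + affine_monom (brk c (brk a b)) (p + m + n) = 0"
    proof -
      have "n + p + m = m + n + p" "p + m + n = m + n + p" by simp_all
      then show ?thesis by (simp only: affine_monom_add[symmetric] jacobi affine_monom_zero)
    qed
    moreover have "(if m + n + p = 0 then of_int m * form a (brk b c) else 0)
      + (if n + p + m = 0 then of_int n * form b (brk c a) else 0)
      + (if p + m + n = 0 then of_int p * form c (brk a b) else 0) = (0 :: complex)"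
    proof (cases "m + n + p = 0")
      case True
      then have p: "p = - m - n" by simp
      show ?thesis unfolding p f1 by (simp add: algebra_simps)
    qed (auto simp: algebra_simps)
    ultimately have "(affine_monom (brk a (brk b c)) (m + n + p)
        + affine_monom (brk b (brk c a)) (n + p + m) + affine_monom (brk c (brk a b)) (p + m + n))
      + ((if m + n + p = 0 then of_int m * form a (brk b c) else 0)
      + (if n + p + m = 0 then of_int n * form b (brk c a) else 0)
      + (if p + m + n = 0 then of_int p * form c (brk a b) else 0)) *\<^sub>C affine_central = 0"
      by (simp only: complex_vector.scale_zero_left add_0_left)
    then show ?thesis unfolding e scaleC_add_left by (simp only: ac_simps)
  qed
  have Jadd: "?J (X + X') Y Z = ?J X Y Z + ?J X' Y Z" for X X' Y Z
    by (simp add: B algebra_simps)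
  have Jcyc: "?J X Y Z = ?J Y Z X" for X Y Z by (simp add: ac_simps)
  have Jcen: "?J (c *\<^sub>C affine_central) Y Z = 0" for c Y Z by (simp add: B)
  have J1: "?J X (affine_monom b n) (affine_monom c p) = 0" for X b n c p
    by (induction X rule: affine_induct) (simp_all only: J0 Jadd Jcen add_0_left)
  have J2: "?J Y (affine_monom c p) X = 0" for X Y c p
  proof (induction Y rule: affine_induct)
    case (monom a n)
    show ?case using J1 Jcyc by metis
  qed (simp_all only: Jadd Jcen add_0_left)
  show "?J X Y Z = 0" for X Y Z
  proof -
    have "?J Y Z X = 0"
    proof -
      have "?J Z X Y = 0"
      proof (induction Z rule: affine_induct)
        case (monom a n)
        show ?case using J2 Jcyc by metis
      qed (simp_all only: Jadd Jcen add_0_left)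
      then show ?thesis using Jcyc by metis
    qed
    then show ?thesis using Jcyc by metis
  qed
qed

end

end

section \<open>Restricted modules and the category E\<close>

definition restricted_module ::
    "('g::complex_vector affine \<Rightarrow> 'w::complex_vector \<Rightarrow> 'w) \<Rightarrow> bool"
  where "restricted_module act \<longleftrightarrow>
    (\<forall>a w. \<exists>N. \<forall>n\<ge>N. act (affine_monom a n) w = 0)"

text \<open>
  A formal Laurent series in \<open>U[[x, x^-1]]\<close> is a function \<open>int \<Rightarrow> 'u\<close> giving the coefficient of each
  power of \<open>x\<close>. Since \<open>a(x) = \<Sum>n. a(n) x^(-n-1)\<close>, the coefficient of \<open>x^k\<close> in \<open>a(x) u\<close> is
  \<open>a(-k-1) u\<close>.
\<close>

definition gen_series ::
    "('g::complex_vector affine \<Rightarrow> 'u::complex_vector \<Rightarrow> 'u) \<Rightarrow> 'g \<Rightarrow> 'u \<Rightarrow> int \<Rightarrow> 'u"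
  where "gen_series act a u k = act (affine_monom a (- k - 1)) u"

definition poly_times_series :: "complex poly \<Rightarrow> (int \<Rightarrow> 'u::complex_vector) \<Rightarrow> int \<Rightarrow> 'u"
  where "poly_times_series p f k = (\<Sum>i\<le>Polynomial.degree p. coeff p i *\<^sub>C f (k - int i))"

definition category_E ::
    "('g::complex_vector affine \<Rightarrow> 'u::complex_vector \<Rightarrow> 'u) \<Rightarrow> bool"
  where "category_E act \<longleftrightarrow>
    (\<exists>p :: complex poly. p \<noteq> 0 \<and> (\<forall>a u. poly_times_series p (gen_series act a u) = (\<lambda>_. 0)))"

end

theory Submission
  imports Defs
    "HOL-Computational_Algebra.Fundamental_Theorem_Algebra"
    "HOL-Analysis.Continuum_Not_Denumerable"
begin

text \<open>
  Let \<open>M\<close> be a submodule of \<open>W \<otimes> U\<close>. The proof shows that \<open>M\<close> is stable under the two actions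
  \<open>X \<otimes> 1\<close> and \<open>1 \<otimes> X\<close> separately, and not only under their sum; from there on only
  irreducibility and Schur's lemma count.

  \<^item> Separation of the actions (\<open>submodule_left_monom\<close>). If \<open>p(x) a(x)\<close> vanishes on \<open>U\<close>, then each
    coefficient of \<open>p(x) a(x)\<close> acts on \<open>W \<otimes> U\<close> through \<open>W\<close> alone. On a given vector of \<open>W \<otimes> U\<close>,
    the operators \<open>a(n) \<otimes> 1\<close> vanish for large \<open>n\<close> because \<open>W\<close> is restricted, so the factor \<open>p(x)\<close>
    can be inverted: solving for the coefficient at the lowest power in \<open>p\<close>, descending in \<open>n\<close>,
    expresses each \<open>a(n) \<otimes> 1\<close> through the operators that preserve \<open>M\<close>.

  \<^item> Schur's lemma in countable dimension (\<open>schur_dixmier\<close>). Countability of the dimension of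
    \<open>\<gg>\<close> passes to every irreducible module. If an endomorphism \<open>f\<close> were not scalar, then all
    \<open>f - c\<close> would be invertible, and the uncountably many vectors \<open>(f - c)\<^sup>-\<^sup>1 w\<close> would be linearly
    independent by partial fractions, which no space of countable dimension allows. In particular, the central element acts on \<open>W\<close> by a scalar,
    so it does not disturb the separation of the actions.

  \<^item> Subspaces stable under both actions (\<open>bistable_subspace_trivial\<close>). A nonzero vector of \<open>M\<close>
    with the fewest nonzero coordinates relative to a basis of \<open>U\<close> generates under the action on
    \<open>W\<close> a copy of \<open>W\<close>, and by Schur's lemma this copy is \<open>W \<otimes> u\<close> for one vector \<open>u \<noteq> 0\<close>. The
    action on \<open>U\<close> then moves \<open>u\<close> to all of \<open>U\<close>.
\<close>

section \<open>Linear independence in spaces of countable dimension\<close>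

lemma independent_subset_countable_span:
  fixes S T :: "'a::complex_vector set"
  assumes S: "countable S" and T: "complex_vector.independent T" "T \<subseteq> complex_vector.span S"
  shows "countable T"
proof -
  let ?FS = "{F. finite F \<and> F \<subseteq> S}"
  have "T \<subseteq> (\<Union>F\<in>?FS. T \<inter> complex_vector.span F)"
  proof
    fix x assume x: "x \<in> T"
    then have "x \<in> complex_vector.span S" using T(2) by auto
    then obtain F r where F: "finite F" "F \<subseteq> S" "x = (\<Sum>a\<in>F. r a *\<^sub>C a)"
      unfolding complex_vector.span_explicit by auto
    have "x \<in> complex_vector.span F"
      unfolding F(3)
      by (intro complex_vector.span_sum complex_vector.span_scale complex_vector.span_base)
    then show "x \<in> (\<Union>F\<in>?FS. T \<inter> complex_vector.span F)" using F x by auto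
  qed
  moreover have "countable (\<Union>F\<in>?FS. T \<inter> complex_vector.span F)"
  proof (rule countable_UN)
    show "countable ?FS" using S by (rule countable_Collect_finite_subset)
    fix F assume "F \<in> ?FS"
    moreover have "complex_vector.independent (T \<inter> complex_vector.span F)"
      using T(1) by (rule complex_vector.independent_mono) auto
    ultimately have "finite (T \<inter> complex_vector.span F)"
      using complex_vector.independent_span_bound[of F "T \<inter> complex_vector.span F"] by auto
    then show "countable (T \<inter> complex_vector.span F)" by (rule countable_finite)
  qed
  ultimately show ?thesis by (rule countable_subset)
qed

lemma uncountable_UNIV_complex: "uncountable (UNIV :: complex set)"
proof
  assume "countable (UNIV :: complex set)"
  then have "countable (range complex_of_real)" by (rule countable_subset[rotated]) auto
  then have "countable (UNIV :: real set)"
    by (rule countable_image_inj_on) (simp add: inj_on_def)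
  then show False using uncountable_UNIV_real by simp
qed

section \<open>Polynomials in an endomorphism\<close>

text \<open>Horner's scheme for the vector \<open>p(f) v\<close>.\<close>

definition poly_endo ::
    "('v::complex_vector \<Rightarrow> 'v) \<Rightarrow> complex poly \<Rightarrow> 'v \<Rightarrow> 'v"
  where "poly_endo f p v = fold_coeffs (\<lambda>a r. a *\<^sub>C v + f r) p 0"

context
  fixes f :: "'v::complex_vector \<Rightarrow> 'v"
  assumes lin: "clinear f"
begin

lemma endo_add: "f (x + y) = f x + f y" and endo_scale: "f (c *\<^sub>C x) = c *\<^sub>C f x"
  using lin by (simp_all add: clinear_iff)

lemma endo_0: "f 0 = 0"
  using endo_scale[of 0 0] by simp

lemma poly_endo_0 [simp]: "poly_endo f 0 v = 0"
  by (simp add: poly_endo_def)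

lemma poly_endo_pCons: "poly_endo f (pCons a p) v = a *\<^sub>C v + f (poly_endo f p v)"
  by (cases "a = 0 \<and> p = 0") (auto simp: poly_endo_def endo_0)

lemma poly_endo_add: "poly_endo f (p + q) v = poly_endo f p v + poly_endo f q v"
  by (induction p q rule: poly_induct2)
    (simp_all add: poly_endo_pCons endo_add scaleC_add_left algebra_simps)

lemma poly_endo_smult: "poly_endo f (smult c p) v = c *\<^sub>C poly_endo f p v"
  by (induction p) (simp_all add: poly_endo_pCons endo_scale scaleC_add_right scaleC_scaleC)

lemma poly_endo_mult: "poly_endo f (p * q) v = poly_endo f p (poly_endo f q v)"
  by (induction p) (simp_all add: poly_endo_add poly_endo_smult poly_endo_pCons endo_0)

lemma poly_endo_sum: "poly_endo f (\<Sum>i\<in>I. g i) v = (\<Sum>i\<in>I. poly_endo f (g i) v)"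
  by (induction I rule: infinite_finite_induct) (simp_all add: poly_endo_add)

lemma poly_endo_linear_factor: "poly_endo f [:- c, 1:] v = f v - c *\<^sub>C v"
  by (simp add: poly_endo_pCons endo_0 scaleC_one)

lemma poly_endo_scale_right: "poly_endo f p (c *\<^sub>C v) = c *\<^sub>C poly_endo f p v"
  by (induction p)
    (simp_all add: poly_endo_pCons endo_scale scaleC_add_right scaleC_scaleC mult.commute)

lemma poly_endo_add_right: "poly_endo f p (v + w) = poly_endo f p v + poly_endo f p w"
  by (induction p) (simp_all add: poly_endo_pCons endo_add scaleC_add_right algebra_simps)

lemma poly_endo_sum_right: "poly_endo f p (\<Sum>i\<in>I. g i) = (\<Sum>i\<in>I. poly_endo f p (g i))"
proof (induction I rule: infinite_finite_induct)
  case (insert i I)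
  then show ?case by (simp add: poly_endo_add_right)
qed (use poly_endo_scale_right[of p 0 0] in simp_all)

text \<open>Over the complex numbers, \<open>p(f)\<close> is a product of a nonzero scalar and factors \<open>f - c\<close>, each
  of them injective.\<close>

lemma poly_endo_injective:
  assumes no_eigen: "\<And>c v. f v = c *\<^sub>C v \<Longrightarrow> v = 0"
    and p: "p \<noteq> 0" "poly_endo f p v = 0"
  shows "v = 0"
  using p
proof (induction "degree p" arbitrary: p)
  case 0
  then obtain a where "p = [:a:]" by (metis degree_eq_zeroE)
  with 0 show ?case by (simp add: poly_endo_pCons endo_0)
next
  case (Suc n)
  then have "\<not> constant (poly p)" by (simp add: constant_degree)
  then obtain c where "poly p c = 0" using fundamental_theorem_of_algebra by blast
  then obtain q where q: "p = [:- c, 1:] * q" by (metis poly_eq_0_iff_dvd dvdE)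
  then have "q \<noteq> 0" using Suc.prems by auto
  then have "degree q = n" using Suc.hyps(2) q by (simp add: degree_mult_eq del: mult_pCons_left)
  moreover have "poly_endo f q v = 0"
    using no_eigen[of "poly_endo f q v" c] Suc.prems(2)
    unfolding q poly_endo_mult poly_endo_linear_factor by simp
  ultimately show ?case using Suc.hyps(1)[of q] \<open>q \<noteq> 0\<close> by simp
qed

text \<open>
  The partial fractions \<open>1 / (x - c)\<close> are linearly independent rational functions; multiplying a
  linear relation between the vectors \<open>(f - c)\<^sup>-\<^sup>1 w\<close> by a common denominator turns it into
  \<open>q(f) w = 0\<close> for a polynomial \<open>q\<close>, which must be \<open>0\<close>.
\<close>

lemma independent_resolvents:
  assumes no_eigen: "\<And>c v. f v = c *\<^sub>C v \<Longrightarrow> v = 0"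
    and w: "w \<noteq> 0" and r: "\<And>c. f (r c) - c *\<^sub>C r c = w"
  shows "inj r" and "complex_vector.independent (range r)"
proof -
  show inj: "inj r"
  proof (rule injI, rule ccontr)
    fix c d assume cd: "r c = r d" "c \<noteq> d"
    have "(c - d) *\<^sub>C r c = (f (r d) - d *\<^sub>C r d) - (f (r c) - c *\<^sub>C r c)"
      by (simp add: cd(1) complex_vector.scale_left_diff_distrib)
    then have "(c - d) *\<^sub>C r c = 0" by (simp add: r)
    then have "r c = 0" using cd(2) by simp
    then show False using r[of c] w endo_0 by simp
  qed
  have coeffs_0: "a c = 0"
    if S: "finite S" "c \<in> S" and rel: "(\<Sum>c\<in>S. a c *\<^sub>C r c) = 0" for S a c
  proof -
    define D where "D c = (\<Prod>d\<in>S - {c}. [:- d, 1:])" for c :: complex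
    have D: "(\<Prod>d\<in>S. [:- d, 1:]) = D c * [:- c, 1:]" if "c \<in> S" for c
      unfolding D_def using S that by (subst prod.remove[of S c]) (simp_all add: mult.commute)
    have "poly_endo f (\<Sum>c\<in>S. smult (a c) (D c)) w
        = (\<Sum>c\<in>S. a c *\<^sub>C poly_endo f (D c * [:- c, 1:]) (r c))"
      by (simp only: poly_endo_sum poly_endo_smult poly_endo_mult poly_endo_linear_factor r)
    also have "\<dots> = (\<Sum>c\<in>S. poly_endo f (\<Prod>d\<in>S. [:- d, 1:]) (a c *\<^sub>C r c))"
      by (intro sum.cong refl) (simp only: D poly_endo_scale_right)
    also have "\<dots> = 0"
      using poly_endo_scale_right[of _ 0 0]
      by (simp only: poly_endo_sum_right[symmetric] rel) simp
    finally have q0: "(\<Sum>c\<in>S. smult (a c) (D c)) = 0"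
      using poly_endo_injective[of _ w] no_eigen w by blast
    \<comment> \<open>At \<open>x = c\<close> only the summand of \<open>c\<close> survives.\<close>
    have "poly (\<Sum>c\<in>S. smult (a c) (D c)) c = (\<Sum>d\<in>S. if d = c then a c * poly (D c) c else 0)"
      unfolding poly_sum
    proof (intro sum.cong refl)
      fix d assume "d \<in> S"
      have "poly (D d) c = 0" if "d \<noteq> c"
        unfolding D_def poly_prod using S that by (intro prod_zero) auto
      then show "poly (smult (a d) (D d)) c = (if d = c then a c * poly (D c) c else 0)" by simp
    qed
    then have "a c * poly (D c) c = 0" using q0 S by simp
    moreover have "poly (D c) c \<noteq> 0"
      unfolding D_def poly_prod using S by simp
    ultimately show ?thesis by simp
  qed
  show "complex_vector.independent (range r)"
    unfolding complex_vector.independent_explicit_finite_subsets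
  proof (intro allI impI ballI)
    fix T u x
    assume T: "T \<subseteq> range r" "finite T" "(\<Sum>v\<in>T. u v *\<^sub>C v) = 0" "x \<in> T"
    define S where "S = r -` T"
    have "T = r ` S" using T(1) by (auto simp: S_def)
    then have "(\<Sum>c\<in>S. u (r c) *\<^sub>C r c) = 0"
      using T(3) inj by (simp add: sum.reindex inj_on_subset)
    moreover have "finite S" using T(2) inj by (simp add: S_def finite_vimageI)
    moreover obtain c where "x = r c" "c \<in> S" using T(4) \<open>T = r ` S\<close> by auto
    ultimately show "u x = 0" using coeffs_0[of S c "\<lambda>c. u (r c)"] by simp
  qed
qed

end

section \<open>Schur's lemma in countable dimension\<close>

lemma
  assumes "irreducible_module brk act"
  shows irreducible_lie_module: "lie_module brk act"
    and irreducible_bilinear: "cbilinear act"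
    and irreducible_nonzero: "\<exists>v. v \<noteq> (0 :: 'v::complex_vector)"
    and irreducible_submodule: "submodule act (N :: 'v set) \<Longrightarrow> N = {0} \<or> N = UNIV"
proof -
  show m: "lie_module brk act" using assms by (simp add: irreducible_module_def)
  show "cbilinear act" using m by (rule lie_module.act_bilinear)
  show "\<exists>v. v \<noteq> (0 :: 'v)" using assms by (auto simp: irreducible_module_def)
  show "submodule act N \<Longrightarrow> N = {0} \<or> N = UNIV"
    using assms by (simp add: irreducible_module_def)
qed

text \<open>
  An irreducible module is spanned by the images of one vector under words in a spanning set of the
  Lie algebra.
\<close>

lemma irreducible_countably_spanned:
  fixes act :: "'l::complex_vector \<Rightarrow> 'v::complex_vector \<Rightarrow> 'v" and G :: "'l set"
  assumes irr: "irreducible_module brk act"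
    and G: "countable G" "complex_vector.span G = UNIV"
  obtains S where "countable S" "complex_vector.span S = (UNIV :: 'v set)"
proof -
  note bil = irreducible_bilinear[OF irr]
  obtain w :: 'v where w: "w \<noteq> 0" using irreducible_nonzero[OF irr] by blast
  define S where "S = (\<lambda>xs. foldr act xs w) ` lists G"
  have step: "act g v \<in> complex_vector.span S" if "g \<in> G" "v \<in> complex_vector.span S" for g v
    using that(2)
  proof (induction rule: complex_vector.span_induct_alt)
    case base
    then show ?case by (simp add: cbilinear_zero_right[OF bil] complex_vector.span_zero)
  next
    case (step c s v)
    obtain xs where xs: "s = foldr act xs w" "xs \<in> lists G" using step(1) by (auto simp: S_def)
    then have "act g s = foldr act (g # xs) w" "g # xs \<in> lists G" using that(1) by auto
    then have "act g s \<in> S" unfolding S_def by blast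
    then show ?case using step(2)
      by (simp add: cbilinear_add_right[OF bil] cbilinear_scale_right[OF bil]
          complex_vector.span_add complex_vector.span_scale complex_vector.span_base)
  qed
  have "act x v \<in> complex_vector.span S" if v: "v \<in> complex_vector.span S" for x v
  proof -
    have "x \<in> complex_vector.span G" using G by simp
    then show ?thesis
      by (induction rule: complex_vector.span_induct_alt)
        (simp_all add: cbilinear_zero_left[OF bil] cbilinear_add_left[OF bil]
          cbilinear_scale_left[OF bil] complex_vector.span_zero complex_vector.span_add
          complex_vector.span_scale step v)
  qed
  then have "submodule act (complex_vector.span S)" by (simp add: submodule_def)
  then have "complex_vector.span S = {0} \<or> complex_vector.span S = UNIV"
    by (rule irreducible_submodule[OF irr])
  moreover have "w \<in> S" unfolding S_def by (rule image_eqI[of _ _ "[]"]) auto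
  then have "w \<in> complex_vector.span S" by (rule complex_vector.span_base)
  ultimately have "complex_vector.span S = UNIV" using w by auto
  moreover have "countable S" unfolding S_def using G(1) by simp
  ultimately show ?thesis using that by blast
qed

definition scalar_endomorphisms :: "('l \<Rightarrow> 'v::complex_vector \<Rightarrow> 'v) \<Rightarrow> bool"
  where "scalar_endomorphisms act \<longleftrightarrow>
    (\<forall>f. clinear f \<longrightarrow> (\<forall>x v. f (act x v) = act x (f v)) \<longrightarrow> (\<exists>c. \<forall>v. f v = c *\<^sub>C v))"

lemma scalar_endomorphismsD:
  assumes "scalar_endomorphisms act" "clinear f" "\<And>x v. f (act x v) = act x (f v)"
  shows "\<exists>c. \<forall>v. f v = c *\<^sub>C v"
  using assms unfolding scalar_endomorphisms_def by blast

text \<open>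
  If \<open>f\<close> is not scalar, then every \<open>f - c\<close> is bijective, its kernel and its image being submodules.
  The vectors \<open>(f - c)\<^sup>-\<^sup>1 w\<close> then form an uncountable independent set.
\<close>

lemma schur_dixmier:
  fixes act :: "'l::complex_vector \<Rightarrow> 'v::complex_vector \<Rightarrow> 'v"
  assumes irr: "irreducible_module brk act"
    and S: "countable S" "complex_vector.span S = (UNIV :: 'v set)"
  shows "scalar_endomorphisms act"
  unfolding scalar_endomorphisms_def
proof (intro allI impI, rule ccontr)
  fix f assume f: "clinear f" and comm_all: "\<forall>x v. f (act x v) = act x (f v)"
  assume not_scalar: "\<nexists>c. \<forall>v. f v = c *\<^sub>C v"
  have comm: "f (act x v) = act x (f v)" for x v using comm_all by blast
  note bil = irreducible_bilinear[OF irr]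
  note fs = endo_add[OF f] endo_scale[OF f] endo_0[OF f]
  have diff: "act x (u - v) = act x u - act x v" for x u v
    by (metis add_diff_cancel_right' diff_add_cancel cbilinear_add_right[OF bil])
  have no_eigen: "v = 0" if "f v = c *\<^sub>C v" for c v
  proof -
    have "submodule act {v. f v = c *\<^sub>C v}"
      unfolding submodule_def complex_vector.subspace_def
      by (simp add: fs comm cbilinear_scale_right[OF bil] scaleC_add_right scaleC_scaleC
          mult.commute)
    then show ?thesis using irreducible_submodule[OF irr] not_scalar that by blast
  qed
  have surj: "\<exists>v. f v - c *\<^sub>C v = w" for c w
  proof -
    let ?R = "range (\<lambda>v. f v - c *\<^sub>C v)"
    have "submodule act ?R"
      unfolding submodule_def complex_vector.subspace_def
    proof (intro conjI ballI allI)
      show "0 \<in> ?R" by (rule image_eqI[of _ _ 0]) (simp_all add: fs)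
      fix u v x k assume u: "u \<in> ?R"
      then obtain u' where u': "u = f u' - c *\<^sub>C u'" by auto
      show "k *\<^sub>C u \<in> ?R"
        by (rule image_eqI[of _ _ "k *\<^sub>C u'"])
          (simp_all add: u' fs complex_vector.scale_right_diff_distrib scaleC_scaleC mult.commute)
      show "act x u \<in> ?R"
        by (rule image_eqI[of _ _ "act x u'"])
          (simp_all add: u' comm diff cbilinear_scale_right[OF bil])
      assume "v \<in> ?R"
      then obtain v' where v': "v = f v' - c *\<^sub>C v'" by auto
      show "u + v \<in> ?R"
        by (rule image_eqI[of _ _ "u' + v'"]) (simp_all add: u' v' fs scaleC_add_right)
    qed
    then have "?R = {0} \<or> ?R = UNIV" by (rule irreducible_submodule[OF irr])
    moreover have "?R \<noteq> {0}"
    proof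
      assume "?R = {0}"
      then have "f v - c *\<^sub>C v = 0" for v by blast
      then show False using not_scalar by auto
    qed
    ultimately have "w \<in> ?R" by simp
    then show ?thesis by auto
  qed
  obtain w :: 'v where w: "w \<noteq> 0" using irreducible_nonzero[OF irr] by blast
  obtain r where r: "\<And>c. f (r c) - c *\<^sub>C r c = w"
    using choice[of "\<lambda>c v. f v - c *\<^sub>C v = w"] surj by blast
  have "inj r" by (rule independent_resolvents(1)[OF f _ w r]) (rule no_eigen)
  have "complex_vector.independent (range r)"
    by (rule independent_resolvents(2)[OF f _ w r]) (rule no_eigen)
  then have "countable (range r)"
    by (rule independent_subset_countable_span[OF S(1)]) (simp add: S(2))
  then have "countable (UNIV :: complex set)"
    using \<open>inj r\<close> by (rule countable_image_inj_on)
  then show False using uncountable_UNIV_complex by simp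
qed

section \<open>Coordinates of tensors with respect to a basis of the second factor\<close>

lemma basis_of_UNIV:
  obtains B :: "'a::complex_vector set"
  where "complex_vector.independent B" "complex_vector.span B = UNIV"
proof -
  obtain B :: "'a set" where "complex_vector.independent B" "UNIV \<subseteq> complex_vector.span B"
    by (rule complex_vector.maximal_independent_subset[of UNIV])
  then show ?thesis using that by auto
qed

text \<open>
  The tensor product is the direct sum of the spaces \<open>W \<otimes> b\<close> over the basis vectors \<open>b\<close>; this is the
  projection onto one of them, identified with \<open>W\<close>.
\<close>

definition tensor_coord :: "'u set \<Rightarrow> 'u \<Rightarrow> ('w::complex_vector, 'u::complex_vector) tensor \<Rightarrow> 'w"
  where "tensor_coord B b = tensor_lift (\<lambda>w u. complex_vector.representation B u b *\<^sub>C w)"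

context
  fixes B :: "'u::complex_vector set"
  assumes indep: "complex_vector.independent B" and span: "complex_vector.span B = UNIV"
begin

lemma cbilinear_coord:
  "cbilinear (\<lambda>(w::'w::complex_vector) u. complex_vector.representation B u b *\<^sub>C w)"
  unfolding cbilinear_iff
  using indep span
  by (simp add: complex_vector.representation_add complex_vector.representation_scale
      scaleC_add_left scaleC_add_right scaleC_scaleC mult.commute)

lemma tensor_coord_tensor_of [simp]:
  "tensor_coord B b (w \<otimes> u) = complex_vector.representation B u b *\<^sub>C w"
  unfolding tensor_coord_def by (simp add: cbilinear_coord)

lemma clinear_tensor_coord: "clinear (tensor_coord B b)"
  unfolding tensor_coord_def by (rule clinear_tensor_lift[OF cbilinear_coord])

lemma tensor_coord_add [simp]: "tensor_coord B b (s + t) = tensor_coord B b s + tensor_coord B b t"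
  and tensor_coord_scale [simp]: "tensor_coord B b (c *\<^sub>C t) = c *\<^sub>C tensor_coord B b t"
  by (simp_all add: clinear_tensor_coord[unfolded clinear_iff])

lemma tensor_coord_0 [simp]: "tensor_coord B b 0 = 0"
  using tensor_coord_scale[of b 0 0] by simp

lemma tensor_coord_diff [simp]:
  "tensor_coord B b (s - t) = tensor_coord B b s - tensor_coord B b t"
  by (metis add_diff_cancel_right' diff_add_cancel tensor_coord_add)

lemma tensor_of_sum_right:
  "w \<otimes> (\<Sum>i\<in>I. g i) = (\<Sum>i\<in>I. (w::'w::complex_vector) \<otimes> (g i :: 'u))"
  by (induction I rule: infinite_finite_induct)
    (simp_all add: cbilinear_zero_right[OF cbilinear_tensor_of]
      cbilinear_add_right[OF cbilinear_tensor_of])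

text \<open>The index set may be enlarged freely, which makes the two expansions of a sum comparable.\<close>

lemma tensor_coord_expansion_eventually:
  "\<exists>F. finite F \<and> (\<forall>b. b \<notin> F \<longrightarrow> tensor_coord B b t = 0) \<and>
    (\<forall>G. finite G \<longrightarrow> F \<subseteq> G \<longrightarrow> (\<Sum>b\<in>G. tensor_coord B b t \<otimes> b) = t)"
proof (induction t rule: tensor_induct)
  case (tensor w u)
  let ?r = "complex_vector.representation B u"
  let ?F = "{b. ?r b \<noteq> 0}"
  have expand: "(\<Sum>b\<in>G. tensor_coord B b (w \<otimes> u) \<otimes> b) = w \<otimes> u" if G: "finite G" "?F \<subseteq> G" for G
  proof -
    have "u = (\<Sum>b\<in>?F. ?r b *\<^sub>C b)"
      using complex_vector.sum_nonzero_representation_eq[OF indep] span by simp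
    also have "\<dots> = (\<Sum>b\<in>G. ?r b *\<^sub>C b)" using G by (intro sum.mono_neutral_left) auto
    finally have "w \<otimes> u = (\<Sum>b\<in>G. w \<otimes> (?r b *\<^sub>C b))" by (metis tensor_of_sum_right)
    then show ?thesis
      by (rule trans[symmetric]) (simp add: cbilinear_scale_right[OF cbilinear_tensor_of]
          cbilinear_scale_left[OF cbilinear_tensor_of])
  qed
  show ?case
  proof (intro exI[of _ ?F] conjI allI impI)
    show "finite ?F" by (rule complex_vector.finite_representation)
    show "tensor_coord B b (w \<otimes> u) = 0" if "b \<notin> ?F" for b using that by simp
  qed (rule expand)
next
  case (add s t)
  let ?P = "\<lambda>t F. finite F \<and> (\<forall>b. b \<notin> F \<longrightarrow> tensor_coord B b t = 0) \<and>
    (\<forall>G. finite G \<longrightarrow> F \<subseteq> G \<longrightarrow> (\<Sum>b\<in>G. tensor_coord B b t \<otimes> b) = t)"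
  from add(1) obtain F1 where F1: "?P s F1" ..
  from add(2) obtain F2 where F2: "?P t F2" ..
  show ?case
    by (rule exI[of _ "F1 \<union> F2"])
      (simp add: F1 F2 cbilinear_add_left[OF cbilinear_tensor_of] sum.distrib)
next
  case (scale c t)
  then obtain F where "finite F \<and> (\<forall>b. b \<notin> F \<longrightarrow> tensor_coord B b t = 0) \<and>
    (\<forall>G. finite G \<longrightarrow> F \<subseteq> G \<longrightarrow> (\<Sum>b\<in>G. tensor_coord B b t \<otimes> b) = t)" ..
  then show ?case
    by (intro exI[of _ F]) (simp add: cbilinear_scale_left[OF cbilinear_tensor_of]
        flip: complex_vector.scale_sum_right)
qed

lemma finite_tensor_coord_support: "finite {b. tensor_coord B b t \<noteq> 0}"
proof -
  obtain F where "finite F" "\<forall>b. b \<notin> F \<longrightarrow> tensor_coord B b t = 0"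
    using tensor_coord_expansion_eventually[of t] by blast
  then show ?thesis by (elim finite_subset[rotated]) auto
qed

lemma tensor_coord_expansion:
  assumes G: "finite G" "{b. tensor_coord B b t \<noteq> 0} \<subseteq> G"
  shows "t = (\<Sum>b\<in>G. tensor_coord B b t \<otimes> b)"
proof -
  obtain F where F: "finite F"
    "\<And>G. finite G \<Longrightarrow> F \<subseteq> G \<Longrightarrow> (\<Sum>b\<in>G. tensor_coord B b t \<otimes> b) = t"
    using tensor_coord_expansion_eventually[of t] by blast
  have "t = (\<Sum>b\<in>F \<union> G. tensor_coord B b t \<otimes> b)" using F(2)[of "F \<union> G"] F(1) G(1) by simp
  also have "\<dots> = (\<Sum>b\<in>G. tensor_coord B b t \<otimes> b)"
  proof (rule sum.mono_neutral_right)
    show "\<forall>b\<in>(F \<union> G) - G. tensor_coord B b t \<otimes> b = 0"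
    proof
      fix b assume "b \<in> (F \<union> G) - G"
      then have "tensor_coord B b t = 0" using G(2) by blast
      then show "tensor_coord B b t \<otimes> b = 0"
        by (simp add: cbilinear_zero_left[OF cbilinear_tensor_of])
    qed
  qed (use F(1) G(1) in auto)
  finally show ?thesis .
qed

end

lemma tensor_of_nonzero:
  fixes w :: "'w::complex_vector" and u :: "'u::complex_vector"
  assumes "w \<noteq> 0" "u \<noteq> 0"
  shows "w \<otimes> u \<noteq> 0"
proof
  assume eq: "w \<otimes> u = 0"
  obtain B :: "'u set" where B: "complex_vector.independent B" "complex_vector.span B = UNIV"
    by (rule basis_of_UNIV)
  have "complex_vector.representation B u b = 0" for b
    using arg_cong[OF eq, of "tensor_coord B b"] assms(1)
    by (simp add: tensor_coord_tensor_of[OF B] tensor_coord_0[OF B])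
  then show False
    using complex_vector.sum_nonzero_representation_eq[OF B(1), of u] B(2) assms(2) by simp
qed

section \<open>The two one-sided actions on a tensor product\<close>

text \<open>
  The actions \<open>x \<otimes> 1\<close> and \<open>1 \<otimes> x\<close> are the tensor products with a trivial module on the other side,
  so that all general facts about tensor product modules apply to them.
\<close>

abbreviation left_act ::
    "('l \<Rightarrow> 'w::complex_vector \<Rightarrow> 'w) \<Rightarrow> 'l \<Rightarrow> ('w, 'u::complex_vector) tensor \<Rightarrow> ('w, 'u) tensor"
  where "left_act act \<equiv> tensor_act act (\<lambda>_ _. 0)"

abbreviation right_act ::
    "('l \<Rightarrow> 'u::complex_vector \<Rightarrow> 'u) \<Rightarrow> 'l \<Rightarrow> ('w::complex_vector, 'u) tensor \<Rightarrow> ('w, 'u) tensor"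
  where "right_act act \<equiv> tensor_act (\<lambda>_ _. 0) act"

lemma lie_module_trivial: "lie_algebra brk \<Longrightarrow> lie_module brk (\<lambda>_ _. 0)"
  by (simp add: lie_module_def lie_module_axioms_def cbilinear_iff)

lemma
  assumes m: "lie_module brk act"
  shows lie_module_left_act:
      "lie_module brk (left_act act :: _ \<Rightarrow> ('w::complex_vector, 'u::complex_vector) tensor \<Rightarrow> _)"
    and left_act_tensor_of: "left_act act x (w \<otimes> u) = act x w \<otimes> (u :: 'u)"
proof -
  have t: "lie_module brk (\<lambda>_ _. 0 :: 'u)"
    using m lie_module_trivial lie_module_def by blast
  show "lie_module brk (left_act act :: _ \<Rightarrow> ('w, 'u) tensor \<Rightarrow> _)"
    by (rule lie_module_tensor_act[OF m t])
  show "left_act act x (w \<otimes> u) = act x w \<otimes> u"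
    by (simp add: tensor_act_tensor_of[OF m t] cbilinear_zero_right[OF cbilinear_tensor_of])
qed

lemma
  assumes m: "lie_module brk act"
  shows lie_module_right_act:
      "lie_module brk (right_act act :: _ \<Rightarrow> ('w::complex_vector, 'u::complex_vector) tensor \<Rightarrow> _)"
    and right_act_tensor_of: "right_act act x (w \<otimes> u) = (w :: 'w) \<otimes> act x u"
proof -
  have t: "lie_module brk (\<lambda>_ _. 0 :: 'w)"
    using m lie_module_trivial lie_module_def by blast
  show "lie_module brk (right_act act :: _ \<Rightarrow> ('w, 'u) tensor \<Rightarrow> _)"
    by (rule lie_module_tensor_act[OF t m])
  show "right_act act x (w \<otimes> u) = w \<otimes> act x u"
    by (simp add: tensor_act_tensor_of[OF t m] cbilinear_zero_left[OF cbilinear_tensor_of])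
qed

lemma tensor_act_eq_left_plus_right:
  assumes mW: "lie_module brk actW" and mU: "lie_module brk actU"
  shows "tensor_act actW actU x t = left_act actW x t + right_act actU x t"
proof -
  note bil = lie_module.act_bilinear[OF lie_module_tensor_act[OF mW mU]]
    lie_module.act_bilinear[OF lie_module_left_act[OF mW]]
    lie_module.act_bilinear[OF lie_module_right_act[OF mU]]
  show ?thesis
  proof (induction t rule: tensor_induct)
    case (tensor w u)
    show ?case
      by (simp add: tensor_act_tensor_of[OF mW mU] left_act_tensor_of[OF mW]
          right_act_tensor_of[OF mU])
  qed (simp_all add: bil[THEN cbilinear_add_right] bil[THEN cbilinear_scale_right]
      scaleC_add_right algebra_simps)
qed

lemma tensor_coord_left_act:
  assumes "complex_vector.independent B" "complex_vector.span B = UNIV" and m: "lie_module brk act"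
  shows "tensor_coord B b (left_act act x t) = act x (tensor_coord B b t)"
proof -
  note bil = lie_module.act_bilinear[OF m] lie_module.act_bilinear[OF lie_module_left_act[OF m]]
  show ?thesis
    by (induction t rule: tensor_induct)
      (simp_all add: left_act_tensor_of[OF m] tensor_coord_tensor_of[OF assms(1,2)]
        tensor_coord_add[OF assms(1,2)] tensor_coord_scale[OF assms(1,2)]
        bil[THEN cbilinear_add_right] bil[THEN cbilinear_scale_right])
qed

section \<open>Subspaces stable under both one-sided actions\<close>

text \<open>
  In a nonzero stable subspace \<open>M\<close> take \<open>t \<noteq> 0\<close> with the smallest support in coordinates, and let
  \<open>M'\<close> consist of the vectors of \<open>M\<close> supported inside that of \<open>t\<close>. By minimality, a coordinate
  \<open>\<pi>\<close> in which \<open>t\<close> is nonzero is injective on \<open>M'\<close>, hence an isomorphism of \<open>M'\<close> with \<open>W\<close>. Every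
  other coordinate, composed with the inverse of \<open>\<pi>\<close>, is an endomorphism of \<open>W\<close>, hence a scalar; so
  \<open>M' = W \<otimes> u\<close>, where the coordinates of \<open>u\<close> are these scalars.
\<close>

lemma left_stable_contains_pure_tensors:
  fixes actW :: "'l::complex_vector \<Rightarrow> 'w::complex_vector \<Rightarrow> 'w"
    and M :: "('w, 'u::complex_vector) tensor set"
  assumes irrW: "irreducible_module brk actW"
    and schur: "scalar_endomorphisms actW"
    and M: "submodule (left_act actW) M" "M \<noteq> {0}"
  obtains u where "u \<noteq> 0" "\<And>w. w \<otimes> u \<in> M"
proof -
  note mW = irreducible_lie_module[OF irrW]
  note bilW = irreducible_bilinear[OF irrW]
  obtain B :: "'u set" where B: "complex_vector.independent B" "complex_vector.span B = UNIV"
    by (rule basis_of_UNIV)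
  note coord = tensor_coord_add[OF B] tensor_coord_scale[OF B] tensor_coord_0[OF B]
    tensor_coord_diff[OF B] tensor_coord_left_act[OF B mW]
  have subM: "complex_vector.subspace M" and actM: "\<And>x s. s \<in> M \<Longrightarrow> left_act actW x s \<in> M"
    using M(1) by (auto simp: submodule_def)
  define supp where "supp s = {b. tensor_coord B b s \<noteq> 0}" for s :: "('w, 'u) tensor"
  have fin: "finite (supp s)" for s
    unfolding supp_def by (rule finite_tensor_coord_support[OF B])
  have supp_empty: "s = 0" if "supp s = {}" for s
    using tensor_coord_expansion[OF B, of "{}" s] that by (simp add: supp_def)
  have "\<exists>t0. t0 \<in> M \<and> t0 \<noteq> 0" using M(2) complex_vector.subspace_0[OF subM] by blast
  then obtain t where t: "t \<in> M" "t \<noteq> 0"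
    and t_min: "\<And>s. s \<in> M \<Longrightarrow> s \<noteq> 0 \<Longrightarrow> card (supp t) \<le> card (supp s)"
    using ex_has_least_nat[of "\<lambda>s. s \<in> M \<and> s \<noteq> 0" _ "\<lambda>s. card (supp s)"] by blast
  obtain b0 where b0: "b0 \<in> supp t" using supp_empty t(2) by blast
  define M' where "M' = {s \<in> M. supp s \<subseteq> supp t}"
  have M'_iff: "s \<in> M' \<longleftrightarrow>
      s \<in> M \<and> (\<forall>b. tensor_coord B b t = 0 \<longrightarrow> tensor_coord B b s = 0)" for s
    unfolding M'_def supp_def by blast
  have subM': "complex_vector.subspace M'"
    using subM unfolding complex_vector.subspace_def by (simp add: Ball_def M'_iff coord)
  have actM': "left_act actW x s \<in> M'" if "s \<in> M'" for x s
    using that actM by (simp add: M'_iff coord cbilinear_zero_right[OF bilW])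
  have inj0: "s = 0" if "s \<in> M'" "tensor_coord B b0 s = 0" for s
  proof (rule ccontr)
    assume "s \<noteq> 0"
    have "supp s \<subseteq> supp t - {b0}" using that by (auto simp: M'_def supp_def)
    then have "supp s \<subset> supp t" using b0 by blast
    then have "card (supp s) < card (supp t)" by (rule psubset_card_mono[OF fin])
    then show False using t_min[of s] \<open>s \<noteq> 0\<close> that(1) by (auto simp: M'_def)
  qed
  have inj: "s = s'" if "s \<in> M'" "s' \<in> M'" "tensor_coord B b0 s = tensor_coord B b0 s'" for s s'
    using inj0[of "s - s'"] complex_vector.subspace_diff[OF subM'] that by (simp add: coord)
  have "submodule actW (tensor_coord B b0 ` M')"
    unfolding submodule_def
  proof (intro conjI allI ballI)
    show "complex_vector.subspace (tensor_coord B b0 ` M')"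
      unfolding complex_vector.subspace_def
    proof (intro conjI ballI allI)
      show "0 \<in> tensor_coord B b0 ` M'"
        using complex_vector.subspace_0[OF subM'] by (intro image_eqI[of _ _ 0]) (simp_all add: coord)
      fix x y c assume x: "x \<in> tensor_coord B b0 ` M'"
      then obtain s where s: "s \<in> M'" "x = tensor_coord B b0 s" by auto
      show "c *\<^sub>C x \<in> tensor_coord B b0 ` M'"
        using complex_vector.subspace_scale[OF subM' s(1)] s(2)
        by (intro image_eqI[of _ _ "c *\<^sub>C s"]) (simp_all add: coord)
      assume "y \<in> tensor_coord B b0 ` M'"
      then obtain s' where s': "s' \<in> M'" "y = tensor_coord B b0 s'" by auto
      show "x + y \<in> tensor_coord B b0 ` M'"
        using complex_vector.subspace_add[OF subM' s(1) s'(1)] s(2) s'(2)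
        by (intro image_eqI[of _ _ "s + s'"]) (simp_all add: coord)
    qed
    fix x v assume "v \<in> tensor_coord B b0 ` M'"
    then obtain s where s: "s \<in> M'" "v = tensor_coord B b0 s" by auto
    show "actW x v \<in> tensor_coord B b0 ` M'"
      using actM'[OF s(1)] s(2)
      by (intro image_eqI[of _ _ "left_act actW x s"]) (simp_all add: coord)
  qed
  moreover have "tensor_coord B b0 t \<in> tensor_coord B b0 ` M'" using t by (simp add: M'_def)
  moreover have "tensor_coord B b0 t \<noteq> 0" using b0 by (simp add: supp_def)
  ultimately have surj: "tensor_coord B b0 ` M' = UNIV"
    using irreducible_submodule[OF irrW] by blast
  then have "\<exists>s. s \<in> M' \<and> tensor_coord B b0 s = w" for w by (metis UNIV_I imageE)
  then obtain lift where lift: "\<And>w. lift w \<in> M'" "\<And>w. tensor_coord B b0 (lift w) = w" by metis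
  have lift_add: "lift (v + w) = lift v + lift w" for v w
    by (rule inj) (simp_all add: lift coord complex_vector.subspace_add[OF subM'])
  have lift_scale: "lift (c *\<^sub>C w) = c *\<^sub>C lift w" for c w
    by (rule inj) (simp_all add: lift coord complex_vector.subspace_scale[OF subM'])
  have lift_act: "lift (actW x w) = left_act actW x (lift w)" for x w
    by (rule inj) (simp_all add: lift coord actM')
  have "\<exists>c. \<forall>v. tensor_coord B b (lift v) = c *\<^sub>C v" for b
    by (rule scalar_endomorphismsD[OF schur, of "\<lambda>v. tensor_coord B b (lift v)"])
      (auto simp: clinear_iff lift_add lift_scale lift_act coord)
  then obtain c where c: "\<And>b v. tensor_coord B b (lift v) = c b *\<^sub>C v" by metis
  define u where "u = (\<Sum>b\<in>supp t. c b *\<^sub>C b)"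
  have lift_eq: "lift w = w \<otimes> u" for w
  proof -
    have "lift w = (\<Sum>b\<in>supp t. tensor_coord B b (lift w) \<otimes> b)"
      using tensor_coord_expansion[OF B fin[of t], of "lift w"] lift(1)[of w]
      by (simp add: M'_def supp_def)
    then show ?thesis
      unfolding u_def tensor_of_sum_right[OF B]
      by (simp add: c cbilinear_scale_right[OF cbilinear_tensor_of]
          cbilinear_scale_left[OF cbilinear_tensor_of])
  qed
  have "u \<noteq> 0"
  proof
    assume "u = 0"
    then have "lift (tensor_coord B b0 t) = 0"
      by (simp add: lift_eq cbilinear_zero_right[OF cbilinear_tensor_of])
    then have "tensor_coord B b0 t = 0" using lift(2) coord(3) by metis
    then show False using b0 by (simp add: supp_def)
  qed
  moreover have "w \<otimes> u \<in> M" for w using lift(1)[of w] by (simp add: lift_eq M'_def)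
  ultimately show ?thesis using that by blast
qed

lemma bistable_subspace_trivial:
  fixes actW :: "'l::complex_vector \<Rightarrow> 'w::complex_vector \<Rightarrow> 'w"
    and actU :: "'l \<Rightarrow> 'u::complex_vector \<Rightarrow> 'u"
    and M :: "('w, 'u) tensor set"
  assumes irrW: "irreducible_module brk actW" and irrU: "irreducible_module brk actU"
    and schur: "scalar_endomorphisms actW"
    and left: "submodule (left_act actW) M" and right: "submodule (right_act actU) M"
  shows "M = {0} \<or> M = UNIV"
proof (cases "M = {0}")
  case False
  obtain u where u: "u \<noteq> 0" "\<And>w. w \<otimes> u \<in> M"
    using left_stable_contains_pure_tensors[OF irrW schur left False] by blast
  have subM: "complex_vector.subspace M" and actM: "\<And>x s. s \<in> M \<Longrightarrow> right_act actU x s \<in> M"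
    using right by (auto simp: submodule_def)
  have "w \<otimes> actU x u' \<in> M" if "w \<otimes> u' \<in> M" for x w u'
    using actM[OF that, of x] by (simp add: right_act_tensor_of[OF irreducible_lie_module[OF irrU]])
  then have "submodule actU {u. \<forall>w. w \<otimes> u \<in> M}"
    using subM unfolding submodule_def complex_vector.subspace_def
    by (simp add: cbilinear_zero_right[OF cbilinear_tensor_of]
        cbilinear_add_right[OF cbilinear_tensor_of] cbilinear_scale_right[OF cbilinear_tensor_of])
  then have all: "w \<otimes> u' \<in> M" for w u' using irreducible_submodule[OF irrU] u by blast
  have "t \<in> M" for t
    by (induction t rule: tensor_induct)
      (simp_all add: all complex_vector.subspace_add[OF subM] complex_vector.subspace_scale[OF subM])
  then show ?thesis by auto
qed simp

section \<open>Separating the actions of the affine Lie algebra\<close>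

lemma affine_countably_spanned:
  assumes "countable_dimension TYPE('g::complex_vector)"
  obtains G where "countable G" "complex_vector.span G = (UNIV :: 'g affine set)"
proof -
  obtain B :: "'g set" where B: "countable B" "complex_vector.span B = UNIV"
    using assms by (auto simp: countable_dimension_def)
  define G :: "'g affine set"
    where "G = insert affine_central ((\<lambda>(b, n). affine_monom b n) ` (B \<times> UNIV))"
  have "affine_monom a n \<in> complex_vector.span G" for a n
  proof -
    have "a \<in> complex_vector.span B" using B by simp
    then show ?thesis
    proof (induction rule: complex_vector.span_induct_alt)
      case (step c b a)
      then have "affine_monom b n \<in> G" by (auto simp: G_def)
      then show ?case using step(2)
        by (simp add: affine_monom_add affine_monom_scale complex_vector.span_add
            complex_vector.span_scale complex_vector.span_base)
    qed (simp add: complex_vector.span_zero)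
  qed
  moreover have "affine_central \<in> complex_vector.span G"
    by (rule complex_vector.span_base) (simp add: G_def)
  ultimately have "X \<in> complex_vector.span G" for X
    by (induction X rule: affine_induct)
      (simp_all add: complex_vector.span_add complex_vector.span_scale)
  moreover have "countable G" using B(1) by (simp add: G_def)
  ultimately show ?thesis using that by blast
qed

lemma act_sum_left:
  assumes "cbilinear act"
  shows "act (\<Sum>i\<in>I. x i) v = (\<Sum>i\<in>I. act (x i) v)"
  by (induction I rule: infinite_finite_induct)
    (simp_all add: cbilinear_zero_left[OF assms] cbilinear_add_left[OF assms])

text \<open>The coefficient of \<open>x\<^sup>-\<^sup>m\<^sup>-\<^sup>1\<close> in \<open>p(x) a(x)\<close>, as an element of the affine Lie algebra.\<close>

definition poly_monom :: "complex poly \<Rightarrow> 'g::complex_vector \<Rightarrow> int \<Rightarrow> 'g affine"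
  where "poly_monom p a m = (\<Sum>i\<le>degree p. coeff p i *\<^sub>C affine_monom a (m + int i))"

lemma poly_monom_act_eq_0:
  assumes "cbilinear act" and "poly_times_series p (gen_series act a u) = (\<lambda>_. 0)"
  shows "act (poly_monom p a m) u = 0"
proof -
  have "act (poly_monom p a m) u = poly_times_series p (gen_series act a u) (- m - 1)"
    unfolding poly_monom_def poly_times_series_def gen_series_def act_sum_left[OF assms(1)]
    by (simp add: cbilinear_scale_left[OF assms(1)] algebra_simps)
  then show ?thesis using assms(2) by simp
qed

lemma restricted_left_act:
  assumes m: "lie_module brk act" and "restricted_module act"
  shows "restricted_module (left_act act :: _ \<Rightarrow> ('w::complex_vector, 'u::complex_vector) tensor \<Rightarrow> _)"
  unfolding restricted_module_def
proof (intro allI)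
  fix a and t :: "('w, 'u) tensor"
  note bil = lie_module.act_bilinear[OF lie_module_left_act[OF m]]
  show "\<exists>N. \<forall>n\<ge>N. left_act act (affine_monom a n) t = 0"
  proof (induction t rule: tensor_induct)
    case (tensor w u)
    obtain N where "\<forall>n\<ge>N. act (affine_monom a n) w = 0"
      using assms(2) unfolding restricted_module_def by blast
    then show ?case
      by (intro exI[of _ N]) (simp add: left_act_tensor_of[OF m]
          cbilinear_zero_left[OF cbilinear_tensor_of])
  next
    case (add s t)
    then obtain N N' where "\<forall>n\<ge>N. left_act act (affine_monom a n) s = 0"
      "\<forall>n\<ge>N'. left_act act (affine_monom a n) t = 0" by blast
    then show ?case
      by (intro exI[of _ "max N N'"]) (simp add: cbilinear_add_right[OF bil])
  qed (auto simp: cbilinear_scale_right[OF bil])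
qed

text \<open>
  With \<open>r\<close> the lowest power occurring in \<open>p\<close>, the element \<open>poly_monom p a (n - r)\<close> is a nonzero multiple
  of \<open>a(n)\<close> plus a combination of \<open>a(n + 1), a(n + 2), \<dots>\<close>, so membership in \<open>M\<close> descends from large
  \<open>n\<close>, where the vectors vanish, to all \<open>n\<close>.
\<close>

lemma monom_act_mem_if_poly_monom_act_mem:
  fixes act :: "'g::complex_vector affine \<Rightarrow> 'v::complex_vector \<Rightarrow> 'v"
  assumes bil: "cbilinear act" and res: "restricted_module act"
    and M: "complex_vector.subspace M" and p: "p \<noteq> 0"
    and mem: "\<And>m. act (poly_monom p a m) t \<in> M"
  shows "act (affine_monom a n) t \<in> M"
proof -
  obtain N where N: "\<And>n. n \<ge> N \<Longrightarrow> act (affine_monom a n) t = 0"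
    using res unfolding restricted_module_def by blast
  define r where "r = (LEAST i. coeff p i \<noteq> 0)"
  have "\<exists>i. coeff p i \<noteq> 0" using p by (metis leading_coeff_0_iff)
  then have r: "coeff p r \<noteq> 0" unfolding r_def by (rule LeastI_ex)
  have below_r: "coeff p i = 0" if "i < r" for i using that not_less_Least unfolding r_def by blast
  have r_le: "r \<le> degree p" using r by (rule le_degree)
  show ?thesis
  proof (induction "nat (N - n)" arbitrary: n rule: less_induct)
    case less
    show ?case
    proof (cases "n \<ge> N")
      case True
      then show ?thesis using N complex_vector.subspace_0[OF M] by simp
    next
      case False
      let ?g = "\<lambda>i. coeff p i *\<^sub>C act (affine_monom a (n - int r + int i)) t"
      have "act (poly_monom p a (n - int r)) t = (\<Sum>i\<le>degree p. ?g i)"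
        by (simp add: poly_monom_def act_sum_left[OF bil] cbilinear_scale_left[OF bil])
      also have "\<dots> = ?g r + (\<Sum>i\<in>{..degree p} - {r}. ?g i)"
        using r_le by (intro sum.remove) auto
      finally have eq: "coeff p r *\<^sub>C act (affine_monom a n) t
          = act (poly_monom p a (n - int r)) t - (\<Sum>i\<in>{..degree p} - {r}. ?g i)"
        by simp
      have "?g i \<in> M" if "i \<noteq> r" for i
      proof (cases "i < r")
        case True
        then show ?thesis using complex_vector.subspace_0[OF M] by (simp add: below_r)
      next
        case i: False
        then have "nat (N - (n - int r + int i)) < nat (N - n)" using that False by simp
        then show ?thesis using less complex_vector.subspace_scale[OF M] by blast
      qed
      then have "coeff p r *\<^sub>C act (affine_monom a n) t \<in> M"
        unfolding eq using mem
        by (intro complex_vector.subspace_diff[OF M] complex_vector.subspace_sum[OF M]) auto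
      then have "inverse (coeff p r) *\<^sub>C coeff p r *\<^sub>C act (affine_monom a n) t \<in> M"
        by (rule complex_vector.subspace_scale[OF M])
      then show ?thesis using r by (simp add: scaleC_scaleC scaleC_one)
    qed
  qed
qed

text \<open>
  The coefficients of \<open>p(x) a(x)\<close> act as \<open>0\<close> on \<open>U\<close>, so their one-sided action through \<open>W\<close> agrees
  with their action on the tensor product and preserves \<open>M\<close>. The operators \<open>a(n) \<otimes> 1\<close> are then
  recovered from these coefficients.
\<close>

lemma submodule_left_monom:
  fixes actW :: "'g::complex_vector affine \<Rightarrow> 'w::complex_vector \<Rightarrow> 'w"
    and actU :: "'g affine \<Rightarrow> 'u::complex_vector \<Rightarrow> 'u"
  assumes mW: "lie_module brk actW" and mU: "lie_module brk actU"
    and res: "restricted_module actW" and E: "category_E actU"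
    and M: "submodule (tensor_act actW actU) M" and t: "t \<in> M"
  shows "left_act actW (affine_monom a n) t \<in> M"
proof -
  obtain p where p: "p \<noteq> 0" "\<And>a u. poly_times_series p (gen_series actU a u) = (\<lambda>_. 0)"
    using E by (auto simp: category_E_def)
  note bilR = lie_module.act_bilinear[OF lie_module_right_act[OF mU]]
  have "right_act actU (poly_monom p a m) s = 0" for m and s :: "('w, 'u) tensor"
    by (induction s rule: tensor_induct)
      (simp_all add: right_act_tensor_of[OF mU]
        poly_monom_act_eq_0[OF lie_module.act_bilinear[OF mU] p(2)]
        cbilinear_zero_right[OF cbilinear_tensor_of]
        cbilinear_add_right[OF bilR] cbilinear_scale_right[OF bilR])
  then have "left_act actW (poly_monom p a m) t = tensor_act actW actU (poly_monom p a m) t" for m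
    by (simp add: tensor_act_eq_left_plus_right[OF mW mU])
  then have "left_act actW (poly_monom p a m) t \<in> M" for m
    using M t unfolding submodule_def by metis
  moreover have "complex_vector.subspace M" using M by (simp add: submodule_def)
  ultimately show ?thesis
    using monom_act_mem_if_poly_monom_act_mem[OF
        lie_module.act_bilinear[OF lie_module_left_act[OF mW]] restricted_left_act[OF mW res] _ p(1)]
    by blast
qed

section \<open>Irreducibility of the tensor product\<close>

theorem proposition2p12:
  fixes brk :: "'g::complex_vector \<Rightarrow> 'g \<Rightarrow> 'g"
    and form :: "'g \<Rightarrow> 'g \<Rightarrow> complex"
    and actW :: "'g affine \<Rightarrow> 'w::complex_vector \<Rightarrow> 'w"
    and actU :: "'g affine \<Rightarrow> 'u::complex_vector \<Rightarrow> 'u"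
  assumes "lie_algebra_form brk form"
    and "countable_dimension TYPE('g)"
    and "irreducible_module (affine_brk brk form) actW"
    and "restricted_module actW"
    and "irreducible_module (affine_brk brk form) actU"
    and "category_E actU"
  shows "irreducible_module (affine_brk brk form) (tensor_act actW actU)"
proof -
  let ?b = "affine_brk brk form"
  note irrW = assms(3) and irrU = assms(5)
  note mW = irreducible_lie_module[OF irrW] and mU = irreducible_lie_module[OF irrU]
  note bilW = irreducible_bilinear[OF irrW]
  note bilL = lie_module.act_bilinear[OF lie_module_left_act[OF mW]]
  obtain G :: "'g affine set" where G: "countable G" "complex_vector.span G = UNIV"
    using affine_countably_spanned[OF assms(2)] by blast
  obtain S :: "'w set" where S: "countable S" "complex_vector.span S = UNIV"
    using irreducible_countably_spanned[OF irrW G] by blast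
  note schur = schur_dixmier[OF irrW S]
  have "clinear (actW affine_central)" using bilW unfolding cbilinear_def by blast
  moreover have "actW affine_central (actW x v) = actW x (actW affine_central v)" for x v
    using lie_module.act_brk[OF mW, of affine_central x v]
      lie_algebra_form.affine_brk_central(1)[OF assms(1)] cbilinear_zero_left[OF bilW] by simp
  \<comment> \<open>The central element commutes with the whole algebra, so it acts as an endomorphism of \<open>W\<close>.\<close>
  ultimately have "\<exists>k. \<forall>v. actW affine_central v = k *\<^sub>C v"
    by (rule scalar_endomorphismsD[OF schur])
  then obtain k where k: "\<And>v. actW affine_central v = k *\<^sub>C v" by blast
  have central_scalar: "left_act actW affine_central t = k *\<^sub>C t" for t :: "('w, 'u) tensor"
    by (induction t rule: tensor_induct)
      (simp_all add: left_act_tensor_of[OF mW] k cbilinear_scale_left[OF cbilinear_tensor_of]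
        cbilinear_add_right[OF bilL] cbilinear_scale_right[OF bilL] scaleC_add_right scaleC_scaleC
        mult.commute)
  have trivial: "M = {0} \<or> M = UNIV" if M: "submodule (tensor_act actW actU) M" for M
  proof -
    have subM: "complex_vector.subspace M" using M by (simp add: submodule_def)
    have left: "left_act actW X t \<in> M" if t: "t \<in> M" for X t
    proof (induction X rule: affine_induct)
      case (monom a n)
      show ?case by (rule submodule_left_monom[OF mW mU assms(4,6) M t])
    next
      case (central c)
      show ?case
        using t by (simp add: cbilinear_scale_left[OF bilL] central_scalar
            complex_vector.subspace_scale[OF subM])
    next
      case (add X Y)
      then show ?case by (simp add: cbilinear_add_left[OF bilL] complex_vector.subspace_add[OF subM])
    qed
    have "right_act actU X t = tensor_act actW actU X t - left_act actW X t" for X t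
      by (simp add: tensor_act_eq_left_plus_right[OF mW mU])
    moreover have "tensor_act actW actU X t \<in> M" if "t \<in> M" for X t
      using M that unfolding submodule_def by blast
    ultimately have "right_act actU X t \<in> M" if "t \<in> M" for X t
      using left that complex_vector.subspace_diff[OF subM] by metis
    then show ?thesis
      using bistable_subspace_trivial[OF irrW irrU schur] left subM by (simp add: submodule_def)
  qed
  obtain w :: 'w and u :: 'u where "w \<noteq> 0" "u \<noteq> 0"
    using irreducible_nonzero[OF irrW] irreducible_nonzero[OF irrU] by blast
  then have "w \<otimes> u \<noteq> 0" by (rule tensor_of_nonzero)
  then have "(UNIV :: ('w, 'u) tensor set) \<noteq> {0}" by blast
  then show ?thesis
    unfolding irreducible_module_def using lie_module_tensor_act[OF mW mU] trivial by blast
qed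

end
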